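(* Let $F_1,\dots,F_k$ be real symmetric $n\times n$ matrices, and let $(V,\Lambda)$ be approximate eigenpairs, with $V$ an $n\times p$ matrix ($p\le n$) and $\Lambda=\mathrm{diag}(\hat\lambda_1,\dots,\hat\lambda_p)$ a diagonal matrix, such that $R=\sum_{j=1}^k F_jVf_j(\Lambda)$. Let $V=Q_1T$ be an economy size QR factorization of $V$ ($Q_1$ of size $n\times p$ with orthonormal columns, $T$ of size $p\times p$ upper triangular), and let $Q$ be an $n\times n$ unitary matrix whose first $p$ columns are $Q_1$. Define $$\tilde T=\begin{bmatrix}Tf_1(\Lambda)\\ \vdots\\ Tf_k(\Lambda)\end{bmatrix},\qquad M_S=\begin{bmatrix}\tilde T^T\otimes I_p\\ \mathrm{diag}(\Pi_{p,p}-I_{p^2},\dots,\Pi_{p,p}-I_{p^2})\end{bmatrix},$$ where the lower block of $M_S$ is the $kp^2\times kp^2$ block diagonal matrix with $k$ diagonal blocks equal to $\Pi_{p,p}-I_{p^2}$, and $\Pi_{p,p}$ is the $(p,p)$ commutation matrix. Then there exist symmetric real perturbations $\delta F_1,\dots,\delta F_k$ such that $(V,\Lambda)$ are eigenpairs for $\sum_{j=1}^k(F_j+\delta F_j)f_j(\lambda)$, i.e. $\sum_{j=1}^k(F_j+\delta F_j)Vf_j(\Lambda)=0$, and $$\delta F_j=Q\begin{bmatrix}A_{11}^{(j)}&(A_{21}^{(j)})^T\\ A_{21}^{(j)}&0_{(n-p)\times(n-p)}\end{bmatrix}Q^T,\qquad j=1,\dots,k,$$ where $A_{11}^{(j)}$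 (of size $p\times p$) and $A_{21}^{(j)}$ (of size $(n-p)\times p$) solve the equations $$\begin{bmatrix}A_{21}^{(1)}&\cdots&A_{21}^{(k)}\end{bmatrix}=B_2\tilde T^\dagger\qquad\text{and}\qquad M_S\begin{bmatrix}\mathrm{vec}(A_{11}^{(1)})\\ \vdots\\ \mathrm{vec}(A_{11}^{(k)})\end{bmatrix}=\begin{bmatrix}\mathrm{vec}(B_1)\\ 0\\ \vdots\\ 0\end{bmatrix},$$ and $B_1,B_2$ denote the $p\times p$ and $(n-p)\times p$ blocks of $\begin{bmatrix}B_1\\ B_2\end{bmatrix}=-Q^TR$, respectively.
   Context: Here $f_1,\dots,f_k:\mathbb{C}\to\mathbb{C}$ are scalar functions and $F(\lambda)=\sum_{j=1}^k f_j(\lambda)F_j$ is the associated nonlinear matrix-valued function. The columns of $V$ are (nonzero) approximate eigenvectors $\hat v_1,\dots,\hat v_p$ associated with the approximate eigenvalues $\hat\lambda_1,\dots,\hat\lambda_p$ of $F(\lambda)$. Notation: $f_j(\Lambda)=\mathrm{diag}(f_j(\hat\lambda_1),\dots,f_j(\hat\lambda_p))$; $\mathrm{vec}$ stacks the columns of a matrix; $\otimes$ is the Kronecker product; $I_m$ is the $m\times m$ identity; ${}^T$ is the transpose; $\dagger$ is the Moore-Penrose pseudoinverse; the commutation matrix (perfect shuffle) $\Pi_{p,p}$ is the $p^2\times p^2$ permutation matrix with $\Pi_{p,p}\mathrm{vec}(X)=\mathrm{vec}(X^T)$ for all $p\times p$ matrices $X$.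
   Formalization: The formal theorem additionally assumes that V and Q are real and that all values f_j(λ̂_i) are real; for complex data, with plain transposes and real perturbations, the statement fails in general. *)

theory Defs
  imports "Jordan_Normal_Form.Schur_Decomposition"
begin

text \<open>
  All matrices are complex matrices of \<^typ>\<open>complex mat\<close>; "real matrix" means that all entries
  lie in \<open>\<real>\<close>. Families indexed by $1,\dots,k$ (or $1,\dots,p$) in the mathematics
  are indexed by $0,\dots,k-1$ (resp. $0,\dots,p-1$) here.
\<close>

definition real_entries :: "complex mat \<Rightarrow> bool" where
  "real_entries A \<longleftrightarrow> elements_mat A \<subseteq> \<real>"

definition symmetric_matrix :: "'a mat \<Rightarrow> bool" where
  "symmetric_matrix A \<longleftrightarrow> transpose_mat A = A"

definition orthonormal_cols :: "complex mat \<Rightarrow> bool" where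
  "orthonormal_cols A \<longleftrightarrow> mat_adjoint A * A = 1\<^sub>m (dim_col A)"

definition unitary_matrix :: "complex mat \<Rightarrow> bool" where
  "unitary_matrix A \<longleftrightarrow> square_mat A \<and> orthonormal_cols A"

definition diag_apply :: "(complex \<Rightarrow> complex) \<Rightarrow> complex mat \<Rightarrow> complex mat" where
  "diag_apply g L = mat_diag (dim_row L) (\<lambda>i. g (L $$ (i, i)))"

definition msum :: "nat \<Rightarrow> nat \<Rightarrow> nat \<Rightarrow> (nat \<Rightarrow> complex mat) \<Rightarrow> complex mat" where
  "msum n m k A = mat n m (\<lambda>(a, b). \<Sum>j<k. A j $$ (a, b))"

definition residual ::
  "nat \<Rightarrow> nat \<Rightarrow> nat \<Rightarrow> (nat \<Rightarrow> complex mat) \<Rightarrow> (nat \<Rightarrow> complex \<Rightarrow> complex)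
    \<Rightarrow> complex mat \<Rightarrow> complex mat \<Rightarrow> complex mat" where
  "residual n p k F f V L = msum n p k (\<lambda>j. F j * V * diag_apply (f j) L)"

text \<open>Vertical and horizontal concatenation of $k$ blocks of equal size $r \times c$.\<close>

definition vstack :: "nat \<Rightarrow> nat \<Rightarrow> nat \<Rightarrow> (nat \<Rightarrow> 'a mat) \<Rightarrow> 'a mat" where
  "vstack k r c A = mat (k * r) c (\<lambda>(a, b). A (a div r) $$ (a mod r, b))"

definition hstack :: "nat \<Rightarrow> nat \<Rightarrow> nat \<Rightarrow> (nat \<Rightarrow> 'a mat) \<Rightarrow> 'a mat" where
  "hstack k r c A = mat r (k * c) (\<lambda>(a, b). A (b div c) $$ (a, b mod c))"

definition vstack_vec :: "nat \<Rightarrow> nat \<Rightarrow> (nat \<Rightarrow> 'a vec) \<Rightarrow> 'a vec" where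
  "vstack_vec k r v = vec (k * r) (\<lambda>a. v (a div r) $ (a mod r))"

definition vec_of_cols :: "'a mat \<Rightarrow> 'a vec" where
  "vec_of_cols X = vec (dim_row X * dim_col X) (\<lambda>a. X $$ (a mod dim_row X, a div dim_row X))"

definition kronecker :: "'a::times mat \<Rightarrow> 'a mat \<Rightarrow> 'a mat" where
  "kronecker A B = mat (dim_row A * dim_row B) (dim_col A * dim_col B)
    (\<lambda>(a, b). A $$ (a div dim_row B, b div dim_col B) * B $$ (a mod dim_row B, b mod dim_col B))"

text \<open>
  The $(p,p)$ commutation matrix: row $a = i + jp$ has its $1$ in column $j + ip$.
  The lemma below is its characteristic property.
\<close>

definition commutation_mat :: "nat \<Rightarrow> complex mat" where
  "commutation_mat p = mat (p * p) (p * p)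
    (\<lambda>(a, b). if b = a div p + (a mod p) * p then 1 else 0)"

lemma commutation_mat_vec_of_cols:
  assumes X: "X \<in> carrier_mat p p"
  shows "commutation_mat p *\<^sub>v vec_of_cols X = vec_of_cols (transpose_mat X)"
proof (rule eq_vecI)
  show "dim_vec (commutation_mat p *\<^sub>v vec_of_cols X) = dim_vec (vec_of_cols (transpose_mat X))"
    using X by (simp add: commutation_mat_def vec_of_cols_def)
next
  fix a assume "a < dim_vec (vec_of_cols (transpose_mat X))"
  with X have a: "a < p * p" by (simp add: vec_of_cols_def)
  then have p: "0 < p" by (cases p) auto
  let ?b = "a div p + (a mod p) * p"
  have ad: "a div p < p" using a by (simp add: less_mult_imp_div_less)
  have am: "a mod p < p" using p by simp
  have "?b < p + (a mod p) * p" using ad by simp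
  also have "\<dots> = Suc (a mod p) * p" by simp
  also have "\<dots> \<le> p * p" using am by (intro mult_right_mono) auto
  finally have b: "?b < p * p" .
  have bm: "?b mod p = a div p" "?b div p = a mod p" using ad p by auto
  have "(commutation_mat p *\<^sub>v vec_of_cols X) $ a
      = (\<Sum>b\<in>{0..<p * p}. (if b = ?b then 1 else 0) * X $$ (b mod p, b div p))"
    using X a by (auto simp: commutation_mat_def vec_of_cols_def scalar_prod_def intro!: sum.cong)
  also have "\<dots> = (\<Sum>b\<in>{0..<p * p}. if b = ?b then X $$ (b mod p, b div p) else 0)"
    by (intro sum.cong) auto
  also have "\<dots> = X $$ (?b mod p, ?b div p)"
    using b by (subst sum.delta) auto
  also have "\<dots> = X $$ (a div p, a mod p)" by (simp only: bm)
  also have "\<dots> = vec_of_cols (transpose_mat X) $ a"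
    using X a ad am by (auto simp: vec_of_cols_def)
  finally show "(commutation_mat p *\<^sub>v vec_of_cols X) $ a = vec_of_cols (transpose_mat X) $ a" .
qed

text \<open>The Moore-Penrose pseudoinverse, via the four Penrose conditions.\<close>

definition is_pinv :: "complex mat \<Rightarrow> complex mat \<Rightarrow> bool" where
  "is_pinv A X \<longleftrightarrow> X \<in> carrier_mat (dim_col A) (dim_row A)
    \<and> A * X * A = A \<and> X * A * X = X
    \<and> mat_adjoint (A * X) = A * X \<and> mat_adjoint (X * A) = X * A"

definition pinv :: "complex mat \<Rightarrow> complex mat" where
  "pinv A = (THE X. is_pinv A X)"

definition T_tilde ::
  "nat \<Rightarrow> nat \<Rightarrow> (nat \<Rightarrow> complex \<Rightarrow> complex) \<Rightarrow> complex mat \<Rightarrow> complex mat \<Rightarrow> complex mat" where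
  "T_tilde p k f L T = vstack k p p (\<lambda>j. T * diag_apply (f j) L)"

definition M_S :: "nat \<Rightarrow> nat \<Rightarrow> complex mat \<Rightarrow> complex mat" where
  "M_S p k Tt = kronecker (transpose_mat Tt) (1\<^sub>m p)
    @\<^sub>r diag_block_mat (replicate k (commutation_mat p - 1\<^sub>m (p * p)))"

end

theory Submission
  imports Defs
begin

text \<open>
  With \<open>S\<^sub>j = T f\<^sub>j(\<Lambda>)\<close> one has \<open>Q\<^sup>T V f\<^sub>j(\<Lambda>) = [S\<^sub>j; 0]\<close>, so only the first block column of
  \<open>G\<^sub>j = Q\<^sup>T F\<^sub>j Q\<close> matters, and \<open>B\<^sub>1\<close>, \<open>B\<^sub>2\<close> are the sums of \<open>-G\<^sub>1\<^sub>1 S\<^sub>j\<close> and \<open>-G\<^sub>2\<^sub>1 S\<^sub>j\<close>. The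
  symmetric choice \<open>A\<^sub>1\<^sub>1 = -G\<^sub>1\<^sub>1\<close> therefore solves the system for \<open>M\<^sub>S\<close>, whose lower half says
  exactly that the \<open>A\<^sub>1\<^sub>1\<close> are symmetric. Moreover \<open>B\<^sub>2\<close> is a left multiple of the stacked matrix
  \<open>Tt\<close>, hence is recovered from \<open>B\<^sub>2 Tt\<^sup>\<dagger>\<close> by multiplying with \<open>Tt\<close>, even when \<open>Tt\<close> is rank
  deficient. The \<open>A\<^sub>2\<^sub>1\<close> are real because uniqueness makes the pseudoinverse of a real matrix real.
\<close>

subsection \<open>The Moore-Penrose pseudoinverse\<close>

lemma dim_mat_adjoint [simp]:
  "dim_row (mat_adjoint A) = dim_col A" "dim_col (mat_adjoint A) = dim_row A"
  by (auto simp: mat_adjoint_def)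

lemma mat_adjoint_carrier [simp, intro]:
  "A \<in> carrier_mat m n \<Longrightarrow> mat_adjoint A \<in> carrier_mat n m"
  by (intro carrier_matI) auto

lemma mat_adjoint_index [simp]:
  "i < dim_col A \<Longrightarrow> j < dim_row A \<Longrightarrow> mat_adjoint A $$ (i, j) = conjugate (A $$ (j, i))"
  by (simp add: mat_adjoint_def mat_of_rows_index)

lemma mat_adjoint_adjoint [simp]: "mat_adjoint (mat_adjoint A) = (A :: complex mat)"
  by (rule eq_matI) auto

lemma mat_adjoint_mult:
  fixes A B :: "complex mat"
  assumes "A \<in> carrier_mat l m" "B \<in> carrier_mat m n"
  shows "mat_adjoint (A * B) = mat_adjoint B * mat_adjoint A"
  using assms by (intro eq_matI) (auto simp: scalar_prod_def mult.commute)

lemma map_cnj_mult: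
  assumes "A \<in> carrier_mat l m" "B \<in> carrier_mat m n"
  shows "map_mat cnj (A * B) = map_mat cnj A * map_mat cnj B"
  using assms by (intro eq_matI) (auto simp: scalar_prod_def)

lemma map_cnj_adjoint: "map_mat cnj (mat_adjoint A) = mat_adjoint (map_mat cnj A)"
  by (intro eq_matI) auto

lemma real_entries_index:
  "real_entries A \<longleftrightarrow> (\<forall>i<dim_row A. \<forall>j<dim_col A. A $$ (i, j) \<in> \<real>)"
  unfolding real_entries_def using elements_matI[of A] by blast

text \<open>Entrywise conjugation is compatible with products and adjoints, so this form turns
  closure properties of real matrices into equations between matrices.\<close>

lemma real_entries_iff_map_cnj: "real_entries A \<longleftrightarrow> map_mat cnj A = A"
  by (auto simp: real_entries_index mat_eq_iff Reals_cnj_iff)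

lemma real_entries_mult:
  assumes "real_entries A" "real_entries B" "A \<in> carrier_mat l m" "B \<in> carrier_mat m n"
  shows "real_entries (A * B)"
  using assms map_cnj_mult by (simp add: real_entries_iff_map_cnj)

lemma index_mult_mat_sum:
  fixes A B :: "'a :: semiring_0 mat"
  assumes "A \<in> carrier_mat l m" "B \<in> carrier_mat m n" "i < l" "j < n"
  shows "(A * B) $$ (i, j) = (\<Sum>s<m. A $$ (i, s) * B $$ (s, j))"
  using assms by (simp add: scalar_prod_def lessThan_atLeast0)

text \<open>The diagonal entry \<open>(j, j)\<close> of the Gram matrix is the sum of the squared
  moduli in column \<open>j\<close>. This positivity later turns a generalized inverse over a field
  into one with a Hermitian product.\<close>

lemma adjoint_mult_self_zero:
  fixes A :: "complex mat"
  assumes A: "A \<in> carrier_mat m n" and z: "mat_adjoint A * A = 0\<^sub>m n n"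
  shows "A = 0\<^sub>m m n"
proof (rule eq_matI)
  fix i j assume ij: "i < dim_row (0\<^sub>m m n :: complex mat)" "j < dim_col (0\<^sub>m m n :: complex mat)"
  have "(\<Sum>l<m. cnj (A $$ (l, j)) * A $$ (l, j)) = (mat_adjoint A * A) $$ (j, j)"
    using A ij by (auto simp: scalar_prod_def lessThan_atLeast0)
  also have "\<dots> = 0" using ij by (simp add: z)
  finally have "of_real (\<Sum>l<m. (cmod (A $$ (l, j)))\<^sup>2) = (0 :: complex)"
    by (simp add: complex_norm_square mult.commute del: of_real_power)
  then have "(\<Sum>l<m. (cmod (A $$ (l, j)))\<^sup>2) = 0" by (simp only: of_real_eq_0_iff)
  then have "\<forall>l<m. (cmod (A $$ (l, j)))\<^sup>2 = 0"
    by (subst (asm) sum_nonneg_eq_0_iff) auto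
  then show "A $$ (i, j) = 0\<^sub>m m n $$ (i, j)" using ij by auto
qed (use A in auto)

text \<open>
  Eliminating with a nonzero entry at \<open>(i, j)\<close> as pivot clears row \<open>i\<close> and keeps zero rows zero.
\<close>

lemma generalized_inverse_exists:
  fixes A :: "'a :: field mat"
  assumes "A \<in> carrier_mat m n"
  shows "\<exists>X \<in> carrier_mat n m. A * X * A = A"
  using assms
proof (induction "card {i. i < m \<and> row A i \<noteq> 0\<^sub>v n}" arbitrary: A rule: less_induct)
  case less
  note A = less.prems
  show ?case
  proof (cases "A = 0\<^sub>m m n")
    case True
    then show ?thesis by (intro bexI[of _ "0\<^sub>m n m"]) auto
  next
    case False
    then obtain i j where i: "i < m" and j: "j < n" and nz: "A $$ (i, j) \<noteq> 0"
      using A by (auto simp: mat_eq_iff)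
    \<comment> \<open>\<open>E\<close> is the matrix unit at \<open>(j, i)\<close> divided by the
      pivot. Thus \<open>A * E * A\<close> has rank one, built from column \<open>j\<close> and row
      \<open>i\<close> of \<open>A\<close>, and subtracting it is one elimination step.\<close>
    define E where "E = mat n m (\<lambda>(r, s). if r = j \<and> s = i then 1 / A $$ (i, j) else 0)"
    have E: "E \<in> carrier_mat n m" by (simp add: E_def)
    define B where "B = A - A * E * A"
    have B: "B \<in> carrier_mat m n" unfolding B_def using A E by (intro minus_carrier_mat mult_carrier_mat)
    have AE: "(A * E) $$ (r, s) = (if s = i then A $$ (r, j) / A $$ (i, j) else 0)"
      if "r < m" "s < m" for r s
    proof -
      have "(A * E) $$ (r, s) = (\<Sum>l<n. A $$ (r, l) * E $$ (l, s))"
        using index_mult_mat_sum[OF A E] that by simp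
      also have "\<dots> = (\<Sum>l<n. if l = j then (if s = i then A $$ (r, j) / A $$ (i, j) else 0) else 0)"
        using that by (intro sum.cong) (auto simp: E_def)
      finally show ?thesis using j by simp
    qed
    have AEA: "(A * E * A) $$ (r, s) = A $$ (r, j) / A $$ (i, j) * A $$ (i, s)"
      if "r < m" "s < n" for r s
    proof -
      have "(A * E * A) $$ (r, s) = (\<Sum>l<m. (A * E) $$ (r, l) * A $$ (l, s))"
        using index_mult_mat_sum[of "A * E" m m A n] A E that by simp
      also have "\<dots> = (\<Sum>l<m. if l = i then A $$ (r, j) / A $$ (i, j) * A $$ (l, s) else 0)"
        using that by (intro sum.cong) (auto simp: AE simp del: index_mult_mat)
      finally show ?thesis using i by simp
    qed
    have Brs: "B $$ (r, s) = A $$ (r, s) - A $$ (r, j) / A $$ (i, j) * A $$ (i, s)"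
      if "r < m" "s < n" for r s
      using that A E by (simp add: B_def AEA del: index_mult_mat(1) assoc_mult_mat)
    have "{r. r < m \<and> row B r \<noteq> 0\<^sub>v n} \<subseteq> {r. r < m \<and> row A r \<noteq> 0\<^sub>v n} - {i}"
    proof -
      have "r < m \<Longrightarrow> row A r = 0\<^sub>v n \<Longrightarrow> row B r = 0\<^sub>v n" for r
        using A B j Brs by (auto simp: vec_eq_iff)
      moreover have "row B i = 0\<^sub>v n"
        using A B i Brs nz by (auto simp: vec_eq_iff)
      ultimately show ?thesis by blast
    qed
    moreover have "i \<in> {r. r < m \<and> row A r \<noteq> 0\<^sub>v n}"
      using A i j nz by (auto simp: vec_eq_iff)
    ultimately have "card {r. r < m \<and> row B r \<noteq> 0\<^sub>v n} < card {r. r < m \<and> row A r \<noteq> 0\<^sub>v n}"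
      by (intro psubset_card_mono) auto
    from less.hyps[OF this B] obtain Y where Y: "Y \<in> carrier_mat n m" "B * Y * B = B" by auto
    \<comment> \<open>The factors are chosen so that \<open>A * ?S = B = ?P * A\<close>. Then
      \<open>A * X * A\<close> becomes \<open>B * Y * B + A * E * A\<close>, and the summand
      \<open>E\<close> restores exactly what the elimination removed.\<close>
    let ?S = "1\<^sub>m n - E * A" and ?P = "1\<^sub>m m - A * E"
    define X where "X = ?S * Y * ?P + E"
    have S: "?S \<in> carrier_mat n n" and P: "?P \<in> carrier_mat m m"
      using A E by (auto intro!: minus_carrier_mat)
    have SY: "?S * Y \<in> carrier_mat n m" and SYP: "?S * Y * ?P \<in> carrier_mat n m"
      and BY: "B * Y \<in> carrier_mat m m" and BYP: "B * Y * ?P \<in> carrier_mat m m"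
      and AEc: "A * E \<in> carrier_mat m m"
      using S P Y(1) A B E by (blast intro: mult_carrier_mat)+
    have X: "X \<in> carrier_mat n m" unfolding X_def using E by (rule add_carrier_mat)
    have AS: "A * ?S = B"
      using A E by (simp add: B_def mult_minus_distrib_mat[of _ m n _ n] assoc_mult_mat[of _ m n _ m _ n])
    have PA: "?P * A = B"
      using A E by (simp add: B_def minus_mult_distrib_mat[of _ m m _ _ n])
    have "A * (?S * Y * ?P) = B * Y * ?P"
      by (simp only: assoc_mult_mat[OF A SY P, symmetric] assoc_mult_mat[OF A S Y(1), symmetric] AS)
    then have "A * X = B * Y * ?P + A * E"
      unfolding X_def mult_add_distrib_mat[OF A SYP E] by simp
    then have "A * X * A = B * Y * B + A * E * A"
      by (simp only: add_mult_distrib_mat[OF BYP AEc A] assoc_mult_mat[OF BY P A] PA)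
    also have "\<dots> = A" unfolding Y(2) using A E by (intro eq_matI) (auto simp: B_def)
    finally show ?thesis using X by blast
  qed
qed

text \<open>As for the normal equations of least squares, \<open>X = G * mat_adjoint A\<close>
  works, where \<open>G\<close> is any generalized inverse of the Gram matrix
  \<open>mat_adjoint A * A\<close>.\<close>

lemma hermitian_generalized_inverse_exists:
  fixes A :: "complex mat"
  assumes A: "A \<in> carrier_mat m n"
  shows "\<exists>X \<in> carrier_mat n m. A * X * A = A \<and> mat_adjoint (A * X) = A * X"
proof -
  let ?A' = "mat_adjoint A"
  define H where "H = ?A' * A"
  have A': "?A' \<in> carrier_mat n m" using A by simp
  have H: "H \<in> carrier_mat n n" "mat_adjoint H = H"
    using A A' mat_adjoint_mult[OF A' A] by (auto simp: H_def)
  obtain G where G: "G \<in> carrier_mat n n" "H * G * H = H"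
    using generalized_inverse_exists[OF H(1)] by auto
  \<comment> \<open>The defect \<open>D\<close> is annihilated by \<open>?A'\<close> and also has
    the form \<open>A * (G * H - 1\<^sub>m n)\<close>. Hence its Gram matrix vanishes, and so does
    \<open>D\<close>.\<close>
  define D where "D = A * G * H - A"
  have AGH: "A * G * H \<in> carrier_mat m n" using A G H by (intro mult_carrier_mat)
  have D: "D \<in> carrier_mat m n" unfolding D_def using A by (rule minus_carrier_mat)
  have "?A' * (A * G * H) = H * G * H"
    using A A' G(1) H(1) assoc_mult_mat[OF A' _ H(1), of "A * G"] assoc_mult_mat[OF A' A G(1)]
    by (simp flip: H_def)
  then have A'D: "?A' * D = 0\<^sub>m n n"
    unfolding D_def mult_minus_distrib_mat[OF A' AGH A] using H G(2) by (simp flip: H_def)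
  have "D = A * (G * H - 1\<^sub>m n)"
    unfolding D_def using A G H mult_minus_distrib_mat[OF A, of "G * H" n "1\<^sub>m n"]
    by (simp add: assoc_mult_mat[OF A G(1) H(1)])
  moreover have GH: "G * H - 1\<^sub>m n \<in> carrier_mat n n" by (intro minus_carrier_mat) auto
  ultimately have "mat_adjoint D = mat_adjoint (G * H - 1\<^sub>m n) * ?A'"
    using mat_adjoint_mult[OF A] by simp
  then have "mat_adjoint D * D = mat_adjoint (G * H - 1\<^sub>m n) * (?A' * D)"
    using assoc_mult_mat[OF mat_adjoint_carrier[OF GH] A' D] by simp
  also have "\<dots> = 0\<^sub>m n n" unfolding A'D by (rule right_mult_zero_mat) (use GH in simp)
  finally have "D = 0\<^sub>m m n" by (rule adjoint_mult_self_zero[OF D])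
  moreover have "A * G * H = D + A"
    using A AGH unfolding D_def by (intro eq_matI) (auto simp del: index_mult_mat(1))
  ultimately have AGH_A: "A * G * H = A" using A by simp
  let ?X = "G * ?A'"
  have "A * ?X * A = A"
    using AGH_A A A' G(1) unfolding H_def
    by (simp add: assoc_mult_mat[of _ n n _ m _ n] assoc_mult_mat[of _ m n _ m _ n] assoc_mult_mat[of _ m n _ n _ n])
  moreover have "mat_adjoint (A * ?X) = A * ?X"
  proof -
    \<comment> \<open>\<open>G\<close> need not be Hermitian. Taking adjoints in
      \<open>A * G * H = A\<close> gives \<open>?A' = H * ?G' * ?A'\<close>; inserted into
      \<open>A * G * ?A'\<close>, this replaces \<open>G\<close> by \<open>?G'\<close>, which is the
      adjoint of the same product.\<close>
    let ?G' = "mat_adjoint G"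
    have G': "?G' \<in> carrier_mat n n" using G by simp
    have "?A' = mat_adjoint (A * (G * H))" using AGH_A A G H by (simp add: assoc_mult_mat[OF A G(1) H(1)])
    also have "\<dots> = H * ?G' * ?A'"
      using A G H mat_adjoint_mult[OF A, of "G * H" n] mat_adjoint_mult[OF G(1) H(1)] by simp
    finally have *: "?A' = H * ?G' * ?A'" .
    have "A * ?X = A * (G * (H * ?G' * ?A'))" using * by simp
    also have "\<dots> = A * G * H * (?G' * ?A')"
      using assoc_mult_mat[OF H(1) G' A'] assoc_mult_mat[OF G(1) H(1), of "?G' * ?A'" m]
        assoc_mult_mat[OF A, of "G * H" n "?G' * ?A'" m] assoc_mult_mat[OF A G(1) H(1)] A' G(1) G' H(1)
      by (simp del: assoc_mult_mat)
    also have "\<dots> = A * (?G' * ?A')" unfolding AGH_A ..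
    finally have "A * ?X = A * (?G' * ?A')" .
    moreover have "mat_adjoint (A * ?X) = A * (?G' * ?A')"
    proof -
      have "mat_adjoint (A * ?X) = mat_adjoint ?X * ?A'"
        by (rule mat_adjoint_mult[OF A]) (use G A' in auto)
      also have "mat_adjoint ?X = A * ?G'"
        using mat_adjoint_mult[OF G(1) A'] by simp
      finally show ?thesis by (simp only: assoc_mult_mat[OF A G' A'])
    qed
    ultimately show ?thesis by simp
  qed
  ultimately show ?thesis using G A' by (intro bexI[of _ ?X]) auto
qed

text \<open>If \<open>A X\<close> and \<open>Y A\<close> are Hermitian for generalized inverses \<open>X\<close>, \<open>Y\<close>, then \<open>Y A X\<close> works.\<close>

lemma is_pinv_exists: "\<exists>X. is_pinv A X"
proof -
  define m n where "m = dim_row A" and "n = dim_col A"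
  have A: "A \<in> carrier_mat m n" by (simp add: m_def n_def)
  have A': "mat_adjoint A \<in> carrier_mat n m" using A by simp
  obtain X where X: "X \<in> carrier_mat n m" "A * X * A = A" "mat_adjoint (A * X) = A * X"
    using hermitian_generalized_inverse_exists[OF A] by auto
  \<comment> \<open>Passing to adjoints exchanges the two sides: the adjoint \<open>Y\<close> of
    \<open>Z\<close> is a generalized inverse of \<open>A\<close> for which \<open>Y * A\<close>,
    instead of \<open>A * Y\<close>, is Hermitian.\<close>
  obtain Z where Z: "Z \<in> carrier_mat m n" "mat_adjoint A * Z * mat_adjoint A = mat_adjoint A"
      "mat_adjoint (mat_adjoint A * Z) = mat_adjoint A * Z"
    using hermitian_generalized_inverse_exists[OF A'] by auto
  define Y where "Y = mat_adjoint Z"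
  have Y: "Y \<in> carrier_mat n m" using Z by (simp add: Y_def)
  have A'Z: "mat_adjoint A * Z = Y * A"
    using mat_adjoint_mult[OF A' Z(1)] Z(3) by (simp add: Y_def)
  have YA: "mat_adjoint (Y * A) = Y * A" using Z(3) unfolding A'Z .
  have "mat_adjoint (mat_adjoint A * Z * mat_adjoint A) = A"
    unfolding Z(2) by simp
  then have AYA: "A * (Y * A) = A"
    using mat_adjoint_mult[of "Y * A" n n "mat_adjoint A" m] A A' Y by (simp add: A'Z YA)
  let ?P = "Y * (A * X)"
  have P: "?P \<in> carrier_mat n m" using A X Y by simp
  have AX: "A * X \<in> carrier_mat m m" and YA_c: "Y * A \<in> carrier_mat n n"
    using A X Y by (blast intro: mult_carrier_mat)+
  \<comment> \<open>\<open>A * ?P\<close> collapses to \<open>A * X\<close> and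
    \<open>?P * A\<close> to \<open>Y * A\<close>. Both products are therefore Hermitian, and the
    other two Penrose conditions follow as well.\<close>
  have AP: "A * ?P = A * X"
    by (simp only: assoc_mult_mat[OF Y A X(1), symmetric] assoc_mult_mat[OF A YA_c X(1), symmetric] AYA)
  have PA: "?P * A = Y * A"
    by (simp only: assoc_mult_mat[OF Y AX A] X(2))
  have "?P * A * ?P = ?P"
    by (simp only: PA assoc_mult_mat[OF Y A P] AP)
  then have "is_pinv A ?P"
    unfolding is_pinv_def using P AP PA X YA by (auto simp: m_def n_def)
  then show ?thesis ..
qed

text \<open>The products \<open>A * X\<close> and \<open>X * A\<close> depend on \<open>A\<close>
  alone, being the orthogonal projections onto the ranges of \<open>A\<close> and of its adjoint.
  Hence \<open>X = X * A * X = Y * A * X = Y * A * Y = Y\<close>.\<close>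

lemma is_pinv_unique:
  assumes X: "is_pinv A X" and Y: "is_pinv A Y"
  shows "X = Y"
proof -
  \<comment> \<open>This is stated for arbitrary matrices because it is applied to the adjoints too.
    From \<open>A * X = (A * Y) * (A * X)\<close>, taking adjoints reverses the two Hermitian
    factors, and the reversed product is \<open>A * Y\<close>.\<close>
  have eq: "A * X = A * Y"
    if "A \<in> carrier_mat m n" "X \<in> carrier_mat n m" "Y \<in> carrier_mat n m"
      "A * X * A = A" "A * Y * A = A"
      "mat_adjoint (A * X) = A * X" "mat_adjoint (A * Y) = A * Y"
    for A X Y :: "complex mat" and m n
  proof -
    have AX: "A * X \<in> carrier_mat m m" and AY: "A * Y \<in> carrier_mat m m" using that by auto
    have "A * X = A * Y * A * X" using that by simp
    also have "\<dots> = (A * Y) * (A * X)" using that AY by (intro assoc_mult_mat)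
    also have "\<dots> = mat_adjoint ((A * X) * (A * Y))"
      using mat_adjoint_mult[OF AX AY] that by simp
    also have "(A * X) * (A * Y) = A * X * A * Y"
      using that AX by (intro assoc_mult_mat[symmetric])
    also have "mat_adjoint \<dots> = A * Y" using that by simp
    finally show ?thesis .
  qed
  define m n where "m = dim_row A" and "n = dim_col A"
  have A: "A \<in> carrier_mat m n" by (simp add: m_def n_def)
  note X = X[unfolded is_pinv_def, folded m_def n_def] and Y = Y[unfolded is_pinv_def, folded m_def n_def]
  have c: "X \<in> carrier_mat n m" "Y \<in> carrier_mat n m" using X Y by auto
  have AX: "A * X = A * Y" using eq[OF A] X Y by blast
  let ?a = mat_adjoint
  \<comment> \<open>The adjoint of \<open>Z\<close> meets the hypotheses of \<open>eq\<close> for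
    the adjoint of \<open>A\<close>, so that \<open>eq\<close> also settles the products with
    \<open>A\<close> on the right.\<close>
  have herm: "?a (?a A * ?a Z) = ?a A * ?a Z" and gen: "?a A * ?a Z * ?a A = ?a A"
    if "Z \<in> carrier_mat n m" "A * Z * A = A" "?a (Z * A) = Z * A" for Z
  proof -
    show "?a (?a A * ?a Z) = ?a A * ?a Z" using mat_adjoint_mult[OF that(1) A] that(3) by simp
    have "?a (A * Z * A) = ?a A * (?a Z * ?a A)"
      using mat_adjoint_mult[of "A * Z" m m A n] mat_adjoint_mult[OF A that(1)] A that by simp
    then show "?a A * ?a Z * ?a A = ?a A"
      using that A by (simp add: assoc_mult_mat[of _ n m _ n _ m])
  qed
  have "?a A * ?a X = ?a A * ?a Y"
    using eq[of "?a A" n m "?a X" "?a Y"] A c herm gen X Y by simp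
  then have "?a (X * A) = ?a (Y * A)" using mat_adjoint_mult A c by metis
  then have XA: "X * A = Y * A" using X Y by simp
  have "X = X * A * X" using X by simp
  also have "\<dots> = Y * (A * X)" unfolding XA by (rule assoc_mult_mat[OF c(2) A c(1)])
  also have "\<dots> = Y * A * Y" unfolding AX by (rule assoc_mult_mat[OF c(2) A c(2), symmetric])
  finally show ?thesis using Y by simp
qed

lemma pinv_is_pinv: "is_pinv A (pinv A)"
  unfolding pinv_def using is_pinv_exists is_pinv_unique by (metis theI)

lemma pinv_carrier: "A \<in> carrier_mat m n \<Longrightarrow> pinv A \<in> carrier_mat n m"
  using pinv_is_pinv[of A] by (auto simp: is_pinv_def)

lemma pinv_generalized_inverse: "A * pinv A * A = A"
  using pinv_is_pinv[of A] by (simp add: is_pinv_def)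

text \<open>Conjugating the Penrose conditions entrywise shows that the conjugate of
  \<open>pinv A\<close> is a pseudoinverse of the conjugate of \<open>A\<close>, which is
  \<open>A\<close> itself. Uniqueness makes \<open>pinv A\<close> a fixed point of
  conjugation.\<close>

lemma real_entries_pinv:
  assumes "real_entries A"
  shows "real_entries (pinv A)"
proof -
  let ?X = "pinv A" and ?c = "map_mat cnj"
  define m n where "m = dim_row A" and "n = dim_col A"
  have A: "A \<in> carrier_mat m n" by (simp add: m_def n_def)
  have X: "?X \<in> carrier_mat n m" by (rule pinv_carrier[OF A])
  have AX: "A * ?X \<in> carrier_mat m m" "?X * A \<in> carrier_mat n n" using A X by auto
  have P: "A * ?X * A = A" "?X * A * ?X = ?X"
    "mat_adjoint (A * ?X) = A * ?X" "mat_adjoint (?X * A) = ?X * A"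
    using pinv_is_pinv[of A] by (simp_all add: is_pinv_def)
  have "?c A = A" using assms by (simp add: real_entries_iff_map_cnj)
  then have "is_pinv A (?c ?X)"
    unfolding is_pinv_def assoc_mult_mat[OF A X A] assoc_mult_mat[OF X A X]
    using P[THEN arg_cong[of _ _ ?c]] A X AX
    by (simp add: map_cnj_adjoint map_cnj_mult[OF A X] map_cnj_mult[OF X A]
        map_cnj_mult[OF A AX(2)] map_cnj_mult[OF X AX(1)])
  then have "?c ?X = ?X" using is_pinv_unique pinv_is_pinv by blast
  then show ?thesis by (simp add: real_entries_iff_map_cnj)
qed

subsection \<open>Block matrices\<close>

text \<open>Reindexing by \<open>b = l * p + c\<close>, for which the \<open>div\<close> and
  \<open>mod\<close> in the block definitions evaluate to \<open>l\<close> and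
  \<open>c\<close>.\<close>

lemma sum_lessThan_mult:
  fixes g :: "nat \<Rightarrow> 'a :: comm_monoid_add"
  shows "(\<Sum>b<k * p. g b) = (\<Sum>l<k. \<Sum>c<p. g (l * p + c))"
proof -
  have "sum g {l * p..<l * p + p} = (\<Sum>c<p. g (l * p + c))" for l
    using sum.shift_bounds_nat_ivl[of g 0 "l * p" p] by (simp add: lessThan_atLeast0 add.commute)
  then show ?thesis by (simp flip: sum.nat_group)
qed

lemma block_index_less:
  fixes l c k p :: nat
  assumes "l < k" "c < p"
  shows "l * p + c < k * p"
proof -
  have "l * p + c < Suc l * p" using assms by simp
  also have "\<dots> \<le> k * p" using assms by (intro mult_right_mono) auto
  finally show ?thesis .
qed

lemma msum_carrier [simp]: "msum n m k A \<in> carrier_mat n m"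
  by (simp add: msum_def)

lemma hstack_carrier [simp]: "hstack k r c A \<in> carrier_mat r (k * c)"
  by (simp add: hstack_def)

lemma vstack_carrier [simp]: "vstack k r c A \<in> carrier_mat (k * r) c"
  by (simp add: vstack_def)

lemma msum_cong: "(\<And>j. j < k \<Longrightarrow> A j = B j) \<Longrightarrow> msum n m k A = msum n m k B"
  by (rule eq_matI) (simp_all add: msum_def)

text \<open>Block row times block column. This is how the sums that make up \<open>B1\<close> and
  \<open>B2\<close> become single products with \<open>Tt\<close>.\<close>

lemma hstack_mult_vstack:
  assumes "\<And>j. j < k \<Longrightarrow> A j \<in> carrier_mat r p" "\<And>j. j < k \<Longrightarrow> B j \<in> carrier_mat p c"
  shows "hstack k r p A * vstack k p c B = msum r c k (\<lambda>j. A j * B j)"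
proof (rule eq_matI)
  fix a b assume "a < dim_row (msum r c k (\<lambda>j. A j * B j))" "b < dim_col (msum r c k (\<lambda>j. A j * B j))"
  then have ab: "a < r" "b < c" by (auto simp: msum_def)
  have "(hstack k r p A * vstack k p c B) $$ (a, b)
      = (\<Sum>s<k * p. A (s div p) $$ (a, s mod p) * B (s div p) $$ (s mod p, b))"
    using ab index_mult_mat_sum[OF hstack_carrier vstack_carrier, of a r b c k p A B]
    by (simp add: hstack_def vstack_def)
  also have "\<dots> = (\<Sum>j<k. \<Sum>s<p. A j $$ (a, s) * B j $$ (s, b))"
    unfolding sum_lessThan_mult by (intro sum.cong) auto
  also have "\<dots> = msum r c k (\<lambda>j. A j * B j) $$ (a, b)"
    using ab assms by (simp add: msum_def index_mult_mat_sum[of _ r p _ c] del: index_mult_mat)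
  finally show "(hstack k r p A * vstack k p c B) $$ (a, b) = msum r c k (\<lambda>j. A j * B j) $$ (a, b)" .
qed (simp_all add: hstack_def vstack_def msum_def)

lemma mult_msum:
  assumes P: "P \<in> carrier_mat l n" and A: "\<And>j. j < k \<Longrightarrow> A j \<in> carrier_mat n m"
  shows "P * msum n m k A = msum l m k (\<lambda>j. P * A j)"
proof (rule eq_matI)
  fix a b assume "a < dim_row (msum l m k (\<lambda>j. P * A j))" "b < dim_col (msum l m k (\<lambda>j. P * A j))"
  then have ab: "a < l" "b < m" by (auto simp: msum_def)
  have "(P * msum n m k A) $$ (a, b) = (\<Sum>s<n. \<Sum>j<k. P $$ (a, s) * A j $$ (s, b))"
    using index_mult_mat_sum[OF P msum_carrier ab] ab by (simp add: msum_def sum_distrib_left)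
  also have "\<dots> = (\<Sum>j<k. (P * A j) $$ (a, b))"
    by (subst sum.swap) (simp add: index_mult_mat_sum[OF P A ab] del: index_mult_mat)
  finally show "(P * msum n m k A) $$ (a, b) = msum l m k (\<lambda>j. P * A j) $$ (a, b)"
    using ab by (simp add: msum_def)
qed (use P in \<open>simp_all add: msum_def\<close>)

lemma msum_add:
  assumes "\<And>j. j < k \<Longrightarrow> A j \<in> carrier_mat n m" "\<And>j. j < k \<Longrightarrow> B j \<in> carrier_mat n m"
  shows "msum n m k (\<lambda>j. A j + B j) = msum n m k A + msum n m k B"
  using carrier_matD[OF assms(1)] carrier_matD[OF assms(2)]
  by (intro eq_matI) (simp_all add: msum_def sum.distrib)

lemma msum_uminus:
  assumes "\<And>j. j < k \<Longrightarrow> A j \<in> carrier_mat n m"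
  shows "msum n m k (\<lambda>j. - A j) = - msum n m k A"
  using carrier_matD[OF assms] by (intro eq_matI) (simp_all add: msum_def sum_negf)

lemma index_append_rows:
  assumes "A \<in> carrier_mat r1 c" "B \<in> carrier_mat r2 c" "i < r1 + r2" "j < c"
  shows "(A @\<^sub>r B) $$ (i, j) = (if i < r1 then A $$ (i, j) else B $$ (i - r1, j))"
  using assms by (auto simp: append_rows_def)

lemma msum_append_rows:
  assumes "\<And>j. j < k \<Longrightarrow> A j \<in> carrier_mat r1 m" "\<And>j. j < k \<Longrightarrow> B j \<in> carrier_mat r2 m"
  shows "msum (r1 + r2) m k (\<lambda>j. A j @\<^sub>r B j) = msum r1 m k A @\<^sub>r msum r2 m k B"
proof (rule eq_matI)
  fix i j assume "i < dim_row (msum r1 m k A @\<^sub>r msum r2 m k B)" "j < dim_col (msum r1 m k A @\<^sub>r msum r2 m k B)"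
  then have ij: "i < r1 + r2" "j < m" by (auto simp: msum_def append_rows_def)
  then show "msum (r1 + r2) m k (\<lambda>j. A j @\<^sub>r B j) $$ (i, j) = (msum r1 m k A @\<^sub>r msum r2 m k B) $$ (i, j)"
    using index_append_rows[OF assms, OF _ _ ij] index_append_rows[OF msum_carrier msum_carrier ij]
    by (auto simp: msum_def)
qed (auto simp: msum_def append_rows_def)

text \<open>Serves to read off the two blocks, since \<open>B1\<close> and \<open>B2\<close> are
  given only through their concatenation.\<close>

lemma append_rows_inject:
  assumes A: "A \<in> carrier_mat r1 c" "B \<in> carrier_mat r2 c"
    and C: "C \<in> carrier_mat r1 c" "D \<in> carrier_mat r2 c"
    and eq: "A @\<^sub>r B = C @\<^sub>r D"
  shows "A = C" "B = D"
proof -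
  have e: "(A @\<^sub>r B) $$ (i, j) = (C @\<^sub>r D) $$ (i, j)" for i j using eq by simp
  show "A = C"
  proof (rule eq_matI)
    fix i j assume "i < dim_row C" "j < dim_col C"
    then show "A $$ (i, j) = C $$ (i, j)"
      using e[of i j] C index_append_rows[OF A, of i j] index_append_rows[OF C, of i j] by auto
  qed (use A C in auto)
  show "B = D"
  proof (rule eq_matI)
    fix i j assume "i < dim_row D" "j < dim_col D"
    then show "B $$ (i, j) = D $$ (i, j)"
      using e[of "r1 + i" j] C index_append_rows[OF A, of "r1 + i" j]
        index_append_rows[OF C, of "r1 + i" j] by auto
  qed (use A C in auto)
qed

lemma append_rows_uminus:
  fixes A B :: "'a :: group_add mat"
  assumes "A \<in> carrier_mat r1 c" "B \<in> carrier_mat r2 c"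
  shows "- (A @\<^sub>r B) = (- A) @\<^sub>r (- B)"
  using assms by (intro eq_matI) (auto simp: append_rows_def)

text \<open>The zero rows suppress the second block column. The lemma therefore covers both the
  transformed matrices, whose lower right block is arbitrary, and the perturbations, where that
  block is zero.\<close>

lemma four_block_mult_append_rows_zero:
  fixes A B C D X :: "'a :: comm_ring_1 mat"
  assumes A: "A \<in> carrier_mat r1 c1" "B \<in> carrier_mat r1 c2" "C \<in> carrier_mat r2 c1" "D \<in> carrier_mat r2 c2"
    and X: "X \<in> carrier_mat c1 m"
  shows "four_block_mat A B C D * (X @\<^sub>r 0\<^sub>m c2 m) = (A * X) @\<^sub>r (C * X)"
proof -
  have "A * X \<in> carrier_mat r1 m" "C * X \<in> carrier_mat r2 m" using A X by auto
  then show ?thesis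
    \<comment> \<open>\<open>append_rows\<close> is a four-block matrix whose right blocks have no
      columns; hence the zero matrices of width 0.\<close>
    using mult_four_block_mat[OF A X zero_carrier_mat[of c1 0] zero_carrier_mat[of c2 m] zero_carrier_mat[of c2 0]]
      A X by (simp add: append_rows_def)
qed

text \<open>The case of an identity left factor in the rule that vec(A Y X) is the Kronecker product
  of the transpose of X with A, applied to vec(Y).\<close>

lemma kronecker_one_mult_vec_of_cols:
  fixes X Y :: "'a :: comm_ring_1 mat"
  assumes X: "X \<in> carrier_mat q c" and Y: "Y \<in> carrier_mat r q"
  shows "kronecker (transpose_mat X) (1\<^sub>m r) *\<^sub>v vec_of_cols Y = vec_of_cols (Y * X)"
proof (rule eq_vecI)
  fix a assume "a < dim_vec (vec_of_cols (Y * X))"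
  then have a: "a < r * c" using X Y by (simp add: vec_of_cols_def)
  then have r: "r > 0" by (cases r) auto
  have ad: "a div r < c" "a mod r < r" using a r by (auto simp: less_mult_imp_div_less mult.commute)
  have "(kronecker (transpose_mat X) (1\<^sub>m r) *\<^sub>v vec_of_cols Y) $ a
      = (\<Sum>b<q * r. X $$ (b div r, a div r) * (if a mod r = b mod r then 1 else 0) * Y $$ (b mod r, b div r))"
    using X Y a r ad
    by (auto simp: kronecker_def vec_of_cols_def scalar_prod_def lessThan_atLeast0 mult.commute[of r]
        less_mult_imp_div_less intro!: sum.cong)
  \<comment> \<open>With \<open>b = l * r + d\<close>, the identity factor keeps only the term
    \<open>d = a mod r\<close>.\<close>
  also have "\<dots> = (\<Sum>l<q. \<Sum>d<r. if d = a mod r then Y $$ (d, l) * X $$ (l, a div r) else 0)"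
    unfolding sum_lessThan_mult by (intro sum.cong) auto
  also have "\<dots> = (\<Sum>l<q. Y $$ (a mod r, l) * X $$ (l, a div r))"
    using ad by simp
  also have "\<dots> = vec_of_cols (Y * X) $ a"
    using X Y a ad index_mult_mat_sum[OF Y X ad(2) ad(1)] by (simp add: vec_of_cols_def)
  finally show "(kronecker (transpose_mat X) (1\<^sub>m r) *\<^sub>v vec_of_cols Y) $ a = vec_of_cols (Y * X) $ a" .
qed (use X Y in \<open>simp add: kronecker_def vec_of_cols_def\<close>)

text \<open>Column-major order lists the blocks of a block row one after the other. In terms of
  indices, dividing by \<open>r\<close> and then by \<open>p\<close> is dividing by
  \<open>r * p\<close>.\<close>

lemma vec_of_cols_hstack:
  assumes "\<And>j. j < k \<Longrightarrow> A j \<in> carrier_mat r p"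
  shows "vec_of_cols (hstack k r p A) = vstack_vec k (r * p) (\<lambda>j. vec_of_cols (A j))"
proof (rule eq_vecI)
  fix a assume "a < dim_vec (vstack_vec k (r * p) (\<lambda>j. vec_of_cols (A j)))"
  then have a: "a < k * (r * p)" by (simp add: vstack_vec_def)
  then have r: "r > 0" "p > 0" by (auto intro!: gr0I)
  have j: "a div (r * p) < k" using a by (simp add: less_mult_imp_div_less)
  have ad: "a div r < k * p" using a by (simp add: less_mult_imp_div_less mult.commute mult.left_commute)
  have m: "a mod (r * p) < r * p" using r by simp
  have a': "a < r * (k * p)" using a by (simp add: ac_simps)
  have e: "a mod (r * p) mod r = a mod r" "a mod (r * p) div r = a div r mod p"
      "a div (r * p) = a div r div p"
    using r by (auto simp: mod_mult2_eq div_mult2_eq)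
  have "vec_of_cols (hstack k r p A) $ a = A (a div r div p) $$ (a mod r, a div r mod p)"
    using a' r ad by (simp add: vec_of_cols_def hstack_def)
  also have "\<dots> = vstack_vec k (r * p) (\<lambda>j. vec_of_cols (A j)) $ a"
    using a m carrier_matD[OF assms[OF j]] by (simp add: vec_of_cols_def vstack_vec_def e)
  finally show "vec_of_cols (hstack k r p A) $ a = vstack_vec k (r * p) (\<lambda>j. vec_of_cols (A j)) $ a" .
qed (simp add: vec_of_cols_def hstack_def vstack_vec_def mult.left_commute)

text \<open>Peeling off the first block matches the recursion of \<open>diag_block_mat\<close> and
  drives the induction for its product with a stacked vector.\<close>

lemma vstack_vec_Suc:
  assumes "v 0 \<in> carrier_vec r"
  shows "vstack_vec (Suc k) r v = v 0 @\<^sub>v vstack_vec k r (\<lambda>j. v (Suc j))"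
proof (rule eq_vecI)
  fix a assume "a < dim_vec (v 0 @\<^sub>v vstack_vec k r (\<lambda>j. v (Suc j)))"
  then have a: "a < r + k * r" using assms by (simp add: vstack_vec_def)
  show "vstack_vec (Suc k) r v $ a = (v 0 @\<^sub>v vstack_vec k r (\<lambda>j. v (Suc j))) $ a"
  proof (cases "a < r")
    case True
    then show ?thesis using a assms by (simp add: vstack_vec_def)
  next
    case False
    moreover from this have "r > 0" using a by (cases r) auto
    ultimately show ?thesis using a assms
      by (simp add: vstack_vec_def le_div_geq le_mod_geq)
  qed
qed (use assms in \<open>simp add: vstack_vec_def\<close>)

lemma diag_block_replicate_carrier:
  "B \<in> carrier_mat r r \<Longrightarrow> diag_block_mat (replicate k B) \<in> carrier_mat (k * r) (k * r)"
  by (intro carrier_matI) (auto simp: dim_diag_block_mat sum_list_replicate)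

lemma diag_block_replicate_mult_vstack_vec:
  fixes B :: "'a :: comm_ring_1 mat"
  assumes B: "B \<in> carrier_mat r r" and v: "\<And>j. j < k \<Longrightarrow> v j \<in> carrier_vec r"
  shows "diag_block_mat (replicate k B) *\<^sub>v vstack_vec k r v = vstack_vec k r (\<lambda>j. B *\<^sub>v v j)"
  using v
proof (induction k arbitrary: v)
  case 0
  then show ?case by (auto simp: vstack_vec_def)
next
  case (Suc k)
  let ?D = "diag_block_mat (replicate k B)"
  have D: "?D \<in> carrier_mat (k * r) (k * r)" by (rule diag_block_replicate_carrier[OF B])
  have w: "vstack_vec k r (\<lambda>j. v (Suc j)) \<in> carrier_vec (k * r)" by (simp add: vstack_vec_def)
  have v0: "v 0 \<in> carrier_vec r" using Suc.prems by simp
  have Bv: "B *\<^sub>v v 0 \<in> carrier_vec r" using B v0 by simp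
  have "diag_block_mat (replicate (Suc k) B)
      = four_block_mat B (0\<^sub>m r (k * r)) (0\<^sub>m (k * r) r) ?D"
    using B D by (simp add: Let_def)
  moreover have "?D *\<^sub>v vstack_vec k r (\<lambda>j. v (Suc j)) = vstack_vec k r (\<lambda>j. B *\<^sub>v v (Suc j))"
    using Suc.prems by (intro Suc.IH) auto
  ultimately show ?case
    using B D w v0 Bv by (simp add: vstack_vec_Suc mult_mat_vec_split)
qed

lemma vstack_vec_zero: "vstack_vec k r (\<lambda>j. 0\<^sub>v r) = 0\<^sub>v (k * r)"
  by (rule eq_vecI) (auto simp: vstack_vec_def, metis mod_less_divisor mult_0_right neq0_conv not_less_zero index_zero_vec(1))

lemma vstack_vec_cong: "(\<And>j. j < k \<Longrightarrow> v j = w j) \<Longrightarrow> vstack_vec k r v = vstack_vec k r w"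
  by (rule eq_vecI) (auto simp: vstack_vec_def less_mult_imp_div_less)

text \<open>The Kronecker block collects the products of the \<open>A j\<close> with the blocks of
  \<open>Tt\<close>. Each commutation block sends vec(A) to the difference of vec of the transpose
  and vec(A), which is zero by symmetry.\<close>

lemma M_S_mult_vec:
  assumes Tt: "Tt \<in> carrier_mat (k * p) p"
    and A: "\<And>j. j < k \<Longrightarrow> A j \<in> carrier_mat p p" "\<And>j. j < k \<Longrightarrow> symmetric_matrix (A j)"
  shows "M_S p k Tt *\<^sub>v vstack_vec k (p * p) (\<lambda>j. vec_of_cols (A j))
    = vec_of_cols (hstack k p p A * Tt) @\<^sub>v 0\<^sub>v (k * (p * p))"
proof -
  let ?v = "vstack_vec k (p * p) (\<lambda>j. vec_of_cols (A j))" and ?C = "commutation_mat p - 1\<^sub>m (p * p)"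
  have v: "?v \<in> carrier_vec (k * (p * p))" by (simp add: vstack_vec_def)
  have K: "kronecker (transpose_mat Tt) (1\<^sub>m p) \<in> carrier_mat (p * p) (k * (p * p))"
    using Tt by (intro carrier_matI) (auto simp: kronecker_def)
  have P: "commutation_mat p \<in> carrier_mat (p * p) (p * p)" by (simp add: commutation_mat_def)
  then have C: "?C \<in> carrier_mat (p * p) (p * p)" by (intro minus_carrier_mat) auto
  have vA: "vec_of_cols (A j) \<in> carrier_vec (p * p)" if "j < k" for j
    using A(1)[OF that] by (intro carrier_vecI) (simp add: vec_of_cols_def)
  have "?C *\<^sub>v vec_of_cols (A j) = 0\<^sub>v (p * p)" if "j < k" for j
    using minus_mult_distrib_mat_vec[OF P one_carrier_mat vA[OF that]]
      commutation_mat_vec_of_cols[OF A(1)[OF that]] A(2)[OF that] vA[OF that]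
    by (simp add: symmetric_matrix_def)
  then have "vstack_vec k (p * p) (\<lambda>j. ?C *\<^sub>v vec_of_cols (A j)) = 0\<^sub>v (k * (p * p))"
    unfolding vstack_vec_zero[symmetric] by (rule vstack_vec_cong)
  then have low: "diag_block_mat (replicate k ?C) *\<^sub>v ?v = 0\<^sub>v (k * (p * p))"
    using diag_block_replicate_mult_vstack_vec[OF C vA] by simp
  have "kronecker (transpose_mat Tt) (1\<^sub>m p) *\<^sub>v ?v = vec_of_cols (hstack k p p A * Tt)"
    using kronecker_one_mult_vec_of_cols[OF Tt hstack_carrier, of p A]
    by (simp only: vec_of_cols_hstack[OF A(1)])
  then show ?thesis
    unfolding M_S_def mat_mult_append[OF K diag_block_replicate_carrier[OF C] v] low by simp
qed

text \<open>Lets a family of blocks be defined by prescribing the block row that it forms.\<close>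

lemma hstack_slices:
  assumes "K \<in> carrier_mat r (k * c)"
  shows "hstack k r c (\<lambda>j. mat r c (\<lambda>(a, b). K $$ (a, j * c + b))) = K"
proof (rule eq_matI)
  fix a b assume "a < dim_row K" "b < dim_col K"
  then have "a < r" "b < k * c" using assms by auto
  moreover from this have "b mod c < c" by (cases c) auto
  ultimately show "hstack k r c (\<lambda>j. mat r c (\<lambda>(a, b). K $$ (a, j * c + b))) $$ (a, b) = K $$ (a, b)"
    by (simp add: hstack_def)
qed (use assms in \<open>simp_all add: hstack_def\<close>)

subsection \<open>Symmetric and real matrices\<close>

lemma four_block_mat_split_symmetric:
  assumes G: "G \<in> carrier_mat (p + q) (p + q)" "symmetric_matrix G"
  obtains G11 G21 G22 where "G11 \<in> carrier_mat p p" "G21 \<in> carrier_mat q p" "G22 \<in> carrier_mat q q"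
    "symmetric_matrix G11" "G = four_block_mat G11 (transpose_mat G21) G21 G22"
proof -
  have sym: "G $$ (a, b) = G $$ (b, a)" if "a < p + q" "b < p + q" for a b
    using G that by (metis carrier_matD index_transpose_mat(1) symmetric_matrix_def)
  let ?G11 = "mat p p (\<lambda>(a, b). G $$ (a, b))" and ?G21 = "mat q p (\<lambda>(a, b). G $$ (p + a, b))"
    and ?G22 = "mat q q (\<lambda>(a, b). G $$ (p + a, p + b))"
  have "symmetric_matrix ?G11"
    unfolding symmetric_matrix_def by (rule eq_matI) (simp_all add: sym)
  moreover have "G = four_block_mat ?G11 (transpose_mat ?G21) ?G21 ?G22"
    by (rule eq_matI) (use G in \<open>auto simp: sym\<close>)
  ultimately show thesis by (intro that[of ?G11 ?G21 ?G22]) auto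
qed

text \<open>For real entries the adjoint is the transpose, and a left inverse of a square matrix is
  also a right inverse.\<close>

lemma unitary_real_orthogonal:
  assumes Q: "Q \<in> carrier_mat n n" "real_entries Q" "unitary_matrix Q"
  shows "transpose_mat Q * Q = 1\<^sub>m n" "Q * transpose_mat Q = 1\<^sub>m n"
proof -
  have "mat_adjoint Q = transpose_mat Q"
    using Q by (intro eq_matI) (auto simp: real_entries_index Reals_cnj_iff)
  then show *: "transpose_mat Q * Q = 1\<^sub>m n"
    using Q by (simp add: unitary_matrix_def orthonormal_cols_def)
  show "Q * transpose_mat Q = 1\<^sub>m n"
    using mat_mult_left_right_inverse[OF _ _ *] Q by simp
qed

text \<open>The zero rows meet the columns of \<open>Q\<close> from index \<open>p\<close> on, and
  the columns before that are those of \<open>Q1\<close>.\<close>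

lemma mult_append_rows_zero:
  fixes Q Q1 X :: "'a :: semiring_0 mat"
  assumes Q: "Q \<in> carrier_mat n (p + q)" and Q1: "Q1 \<in> carrier_mat n p" and X: "X \<in> carrier_mat p c"
    and cols: "\<And>i. i < p \<Longrightarrow> col Q i = col Q1 i"
  shows "Q * (X @\<^sub>r 0\<^sub>m q c) = Q1 * X"
proof (rule eq_matI)
  fix a b assume "a < dim_row (Q1 * X)" "b < dim_col (Q1 * X)"
  then have ab: "a < n" "b < c" using Q1 X by auto
  have Z: "0\<^sub>m q c \<in> carrier_mat q c" by simp
  have "(Q * (X @\<^sub>r 0\<^sub>m q c)) $$ (a, b) = (\<Sum>s<p + q. Q $$ (a, s) * (X @\<^sub>r 0\<^sub>m q c) $$ (s, b))"
    by (rule index_mult_mat_sum[OF Q carrier_append_rows[OF X Z] ab])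
  also have "\<dots> = (\<Sum>s<p. Q1 $$ (a, s) * X $$ (s, b))"
  proof (rule sum.mono_neutral_cong_right)
    fix s assume s: "s \<in> {..<p}"
    have "Q $$ (a, s) = col Q s $ a" using Q ab s by simp
    also have "\<dots> = Q1 $$ (a, s)" using cols[of s] Q1 ab s by simp
    finally show "Q $$ (a, s) * (X @\<^sub>r 0\<^sub>m q c) $$ (s, b) = Q1 $$ (a, s) * X $$ (s, b)"
      using index_append_rows[OF X Z _ ab(2)] s by simp
  qed (use index_append_rows[OF X Z _ ab(2)] ab in auto)
  also have "\<dots> = (Q1 * X) $$ (a, b)"
    by (rule index_mult_mat_sum[OF Q1 X ab, symmetric])
  finally show "(Q * (X @\<^sub>r 0\<^sub>m q c)) $$ (a, b) = (Q1 * X) $$ (a, b)" .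
qed (use Q Q1 X in \<open>simp_all add: append_rows_def\<close>)

lemma real_entries_four_block:
  assumes "A \<in> carrier_mat r1 c1" "B \<in> carrier_mat r1 c2" "C \<in> carrier_mat r2 c1" "D \<in> carrier_mat r2 c2"
    and "real_entries A" "real_entries B" "real_entries C" "real_entries D"
  shows "real_entries (four_block_mat A B C D)"
  using assms by (auto simp: real_entries_index)

lemma real_entries_four_blockD:
  assumes c: "A \<in> carrier_mat r1 c1" "B \<in> carrier_mat r1 c2" "C \<in> carrier_mat r2 c1" "D \<in> carrier_mat r2 c2"
    and r: "real_entries (four_block_mat A B C D)"
  shows "real_entries A" "real_entries C"
proof -
  have *: "four_block_mat A B C D $$ (i, j) \<in> \<real>" if "i < r1 + r2" "j < c1 + c2" for i j
    using r c that by (simp add: real_entries_index)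
  show "real_entries A"
    unfolding real_entries_index
  proof (intro allI impI)
    fix i j assume "i < dim_row A" "j < dim_col A"
    then show "A $$ (i, j) \<in> \<real>" using *[of i j] c by simp
  qed
  show "real_entries C"
    unfolding real_entries_index
  proof (intro allI impI)
    fix i j assume "i < dim_row C" "j < dim_col C"
    then show "C $$ (i, j) \<in> \<real>" using *[of "r1 + i" j] c by simp
  qed
qed

lemma real_entries_uminus: "real_entries A \<Longrightarrow> real_entries (- A)"
  by (simp add: real_entries_index)

lemma real_entries_transpose: "real_entries A \<Longrightarrow> real_entries (transpose_mat A)"
  by (simp add: real_entries_index)

lemma real_entries_msum:
  assumes "\<And>j. j < k \<Longrightarrow> A j \<in> carrier_mat n m" "\<And>j. j < k \<Longrightarrow> real_entries (A j)"
  shows "real_entries (msum n m k A)"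
  using assms(2) carrier_matD[OF assms(1)] by (auto simp: real_entries_index msum_def intro!: sum_in_Reals)

lemma real_entries_vstack:
  assumes "\<And>j. j < k \<Longrightarrow> A j \<in> carrier_mat r c" "\<And>j. j < k \<Longrightarrow> real_entries (A j)"
  shows "real_entries (vstack k r c A)"
  unfolding real_entries_index
proof (intro allI impI)
  fix i j assume "i < dim_row (vstack k r c A)" "j < dim_col (vstack k r c A)"
  then have ij: "i < k * r" "j < c" by (auto simp: vstack_def)
  then have "r > 0" by (auto intro!: gr0I)
  then have "i div r < k" "i mod r < r" using ij by (auto simp: less_mult_imp_div_less)
  then show "vstack k r c A $$ (i, j) \<in> \<real>"
    using assms(2)[of "i div r"] carrier_matD[OF assms(1), of "i div r"] ij
    by (simp add: vstack_def real_entries_index)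
qed

text \<open>Used in both directions: to carry the \<open>F j\<close> into the basis of columns of
  \<open>Q\<close>, and to carry the block perturbations back.\<close>

lemma symmetric_congruence:
  fixes M :: "'a :: comm_semiring_0 mat"
  assumes Q: "Q \<in> carrier_mat n m" and M: "M \<in> carrier_mat m m" "symmetric_matrix M"
  shows "symmetric_matrix (Q * M * transpose_mat Q)"
proof -
  have "transpose_mat (Q * M * transpose_mat Q) = Q * transpose_mat (Q * M)"
    using transpose_mult[of "Q * M" n m "transpose_mat Q" n] Q M by simp
  also have "\<dots> = Q * (transpose_mat M * transpose_mat Q)"
    using transpose_mult[OF Q M(1)] by simp
  also have "\<dots> = Q * M * transpose_mat Q"
    using Q M by (simp add: symmetric_matrix_def)
  finally show ?thesis by (simp add: symmetric_matrix_def)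
qed

text \<open>Reality of the scalar functions is asked at the approximate eigenvalues
  \<open>lam i\<close>, which may themselves be complex; it makes the diagonal matrices
  \<open>diag_apply (f j) Lam\<close> real.\<close>

theorem theorem3p3:
  fixes n p k :: nat
    and F :: "nat \<Rightarrow> complex mat"
    and f :: "nat \<Rightarrow> complex \<Rightarrow> complex"
    and lam :: "nat \<Rightarrow> complex"
    and V Lam R Q1 T Q Tt B1 B2 :: "complex mat"
  assumes pn: "p \<le> n"
    and F: "\<And>j. j < k \<Longrightarrow> F j \<in> carrier_mat n n"
           "\<And>j. j < k \<Longrightarrow> real_entries (F j)"
           "\<And>j. j < k \<Longrightarrow> symmetric_matrix (F j)"
    and V: "V \<in> carrier_mat n p" "real_entries V"
           "\<And>i. i < p \<Longrightarrow> col V i \<noteq> 0\<^sub>v n"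
    and Lam: "Lam = mat_diag p lam"
    and f_real: "\<And>i j. i < p \<Longrightarrow> j < k \<Longrightarrow> f j (lam i) \<in> \<real>"
    and R: "R = residual n p k F f V Lam"
    and QR: "Q1 \<in> carrier_mat n p" "orthonormal_cols Q1"
            "T \<in> carrier_mat p p" "upper_triangular T" "V = Q1 * T"
    and Q: "Q \<in> carrier_mat n n" "real_entries Q" "unitary_matrix Q"
           "\<And>i. i < p \<Longrightarrow> col Q i = col Q1 i"
    and Tt: "Tt = T_tilde p k f Lam T"
    and B: "B1 \<in> carrier_mat p p" "B2 \<in> carrier_mat (n - p) p"
           "B1 @\<^sub>r B2 = - (transpose_mat Q * R)"
  shows "\<exists>dF A11 A21 :: nat \<Rightarrow> complex mat.
    (\<forall>j<k. dF j \<in> carrier_mat n n \<and> real_entries (dF j) \<and> symmetric_matrix (dF j)) \<and>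
    residual n p k (\<lambda>j. F j + dF j) f V Lam = 0\<^sub>m n p \<and>
    (\<forall>j<k. A11 j \<in> carrier_mat p p \<and> A21 j \<in> carrier_mat (n - p) p \<and>
       dF j = Q * four_block_mat (A11 j) (transpose_mat (A21 j)) (A21 j) (0\<^sub>m (n - p) (n - p))
                * transpose_mat Q) \<and>
    hstack k (n - p) p A21 = B2 * pinv Tt \<and>
    M_S p k Tt *\<^sub>v vstack_vec k (p * p) (\<lambda>j. vec_of_cols (A11 j))
      = vec_of_cols B1 @\<^sub>v 0\<^sub>v (k * (p * p))"
proof -

  \<comment> \<open>Coordinates with respect to the columns of \<open>Q\<close>\<close>
  define q where "q = n - p"
  have n: "n = p + q" using pn by (simp add: q_def)
  let ?Qt = "transpose_mat Q"
  have Qt: "?Qt \<in> carrier_mat n n" using Q by simp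
  note ortho = unitary_real_orthogonal[OF Q(1-3)]
  define D where "D j = diag_apply (f j) Lam" for j
  have D: "D j \<in> carrier_mat p p" for j by (simp add: D_def diag_apply_def Lam mat_diag_def)
  have D_real: "real_entries (D j)" if "j < k" for j
    using f_real that by (auto simp: D_def diag_apply_def Lam mat_diag_def real_entries_index)
  define S where "S j = T * D j" for j
  have S: "S j \<in> carrier_mat p p" for j using QR(3) D by (simp add: S_def)
  \<comment> \<open>Because \<open>V = Q1 * T\<close> and \<open>Q1\<close> consists of the leading
    columns of \<open>Q\<close>, \<open>X j\<close> holds the coordinates of \<open>V * D j\<close>
    in the basis of columns of \<open>Q\<close>.\<close>
  define X where "X j = S j @\<^sub>r 0\<^sub>m q p" for j
  have X: "X j \<in> carrier_mat n p" for j
    unfolding X_def n by (intro carrier_append_rows S) simp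
  have VD: "V * D j = Q * X j" for j
  proof -
    have "V * D j = Q1 * S j" unfolding QR(5) S_def using QR D by (intro assoc_mult_mat)
    also have "\<dots> = Q * X j" unfolding X_def
      by (rule mult_append_rows_zero[symmetric]) (use Q QR(1) S n in auto)
    finally show ?thesis .
  qed
  have Tt_eq: "Tt = vstack k p p S" by (simp add: Tt T_tilde_def S_def[abs_def] D_def)
  have Tt_c: "Tt \<in> carrier_mat (k * p) p" unfolding Tt_eq by simp

  \<comment> \<open>Blocks of the transformed coefficient matrices\<close>
  define G where "G j = ?Qt * F j * Q" for j
  have G: "G j \<in> carrier_mat n n" "symmetric_matrix (G j)" "real_entries (G j)" if "j < k" for j
  proof -
    show "G j \<in> carrier_mat n n" using F(1)[OF that] Q by (simp add: G_def)
    show "symmetric_matrix (G j)"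
      using symmetric_congruence[OF Qt F(1,3)[OF that]] by (simp add: G_def)
    show "real_entries (G j)" unfolding G_def
      by (rule real_entries_mult[OF real_entries_mult[OF real_entries_transpose[OF Q(2)] F(2)[OF that] Qt F(1)[OF that]]
            Q(2) mult_carrier_mat[OF Qt F(1)[OF that]] Q(1)])
  qed
  have "\<exists>G11 G21 G22. G11 \<in> carrier_mat p p \<and> G21 \<in> carrier_mat q p \<and> G22 \<in> carrier_mat q q \<and>
      symmetric_matrix G11 \<and> G j = four_block_mat G11 (transpose_mat G21) G21 G22" if "j < k" for j
    using four_block_mat_split_symmetric[of "G j" p q] G[OF that] n by metis
  then obtain G11 G21 G22 where Gs: "\<And>j. j < k \<Longrightarrow> G11 j \<in> carrier_mat p p"
      "\<And>j. j < k \<Longrightarrow> G21 j \<in> carrier_mat q p" "\<And>j. j < k \<Longrightarrow> G22 j \<in> carrier_mat q q"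
      "\<And>j. j < k \<Longrightarrow> symmetric_matrix (G11 j)"
      "\<And>j. j < k \<Longrightarrow> G j = four_block_mat (G11 j) (transpose_mat (G21 j)) (G21 j) (G22 j)"
    by metis
  have Gs_real: "real_entries (G11 j)" "real_entries (G21 j)" if "j < k" for j
    using real_entries_four_blockD[OF Gs(1)[OF that] _ Gs(2,3)[OF that], of "transpose_mat (G21 j)"]
      Gs(2)[OF that] G(3)[OF that] unfolding Gs(5)[OF that] by auto

  \<comment> \<open>The diagonal blocks and formulas for \<open>B1\<close> and
    \<open>B2\<close>\<close>
  define A11 where "A11 j = - G11 j" for j
  \<comment> \<open>\<open>C\<close> is auxiliary: it exhibits \<open>B2\<close> as a left multiple
    of \<open>Tt\<close>. The blocks \<open>A21\<close> of the perturbation come from the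
    pseudoinverse and may differ from \<open>C\<close>.\<close>
  define C where "C j = - G21 j" for j
  have A11: "A11 j \<in> carrier_mat p p" "symmetric_matrix (A11 j)" "real_entries (A11 j)"
    and C: "C j \<in> carrier_mat q p" "real_entries (C j)" if "j < k" for j
    using Gs(1,2,4)[OF that] Gs_real[OF that]
    by (auto simp: A11_def C_def symmetric_matrix_def transpose_uminus real_entries_uminus)
  have FVD: "?Qt * (F j * V * D j) = G j * X j" if "j < k" for j
  proof -
    have FQ: "F j * Q \<in> carrier_mat n n" using F(1)[OF that] Q(1) by simp
    have "F j * V * D j = F j * Q * X j"
      by (simp only: assoc_mult_mat[OF F(1)[OF that] V(1) D] VD assoc_mult_mat[OF F(1)[OF that] Q(1) X])
    then show ?thesis
      by (simp only: G_def assoc_mult_mat[OF Qt FQ X, symmetric] assoc_mult_mat[OF Qt F(1)[OF that] Q(1)])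
  qed
  have FVD_c: "F j * V * D j \<in> carrier_mat n p" if "j < k" for j
    using F(1)[OF that] V(1) D[of j] by (blast intro: mult_carrier_mat)
  have R_c: "R \<in> carrier_mat n p" by (simp add: R residual_def)
  have "?Qt * R = msum n p k (\<lambda>j. G j * X j)"
    unfolding R residual_def D_def[symmetric]
    using mult_msum[OF Qt FVD_c] FVD by (simp cong: msum_cong)
  then have "- (?Qt * R) = msum n p k (\<lambda>j. - (G j * X j))"
    using msum_uminus[of k "\<lambda>j. G j * X j" n p, OF mult_carrier_mat[OF G(1) X]] by simp
  also have "\<dots> = msum n p k (\<lambda>j. (A11 j * S j) @\<^sub>r (C j * S j))"
  proof (rule msum_cong)
    fix j assume j: "j < k"
    have "G j * X j = (G11 j * S j) @\<^sub>r (G21 j * S j)"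
      unfolding Gs(5)[OF j] X_def
      by (rule four_block_mult_append_rows_zero[OF Gs(1)[OF j] _ Gs(2,3)[OF j] S]) (use Gs(2)[OF j] in simp)
    then show "- (G j * X j) = (A11 j * S j) @\<^sub>r (C j * S j)"
      using append_rows_uminus[of "G11 j * S j" p p "G21 j * S j" q] Gs(1,2)[OF j] S[of j]
      by (simp add: A11_def C_def)
  qed
  also have "\<dots> = msum p p k (\<lambda>j. A11 j * S j) @\<^sub>r msum q p k (\<lambda>j. C j * S j)"
    unfolding n by (rule msum_append_rows[OF mult_carrier_mat[OF A11(1) S] mult_carrier_mat[OF C(1) S]])
  finally have "B1 @\<^sub>r B2 = msum p p k (\<lambda>j. A11 j * S j) @\<^sub>r msum q p k (\<lambda>j. C j * S j)"
    using B(3) by simp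
  note Bs = append_rows_inject[OF B(1) B(2)[folded q_def] msum_carrier msum_carrier this]
  \<comment> \<open>This is the upper half of the system for \<open>M_S\<close>. The system does not
    determine \<open>A11\<close> in general; the negated blocks of the \<open>G j\<close> are one
    symmetric real solution.\<close>
  have B1: "B1 = hstack k p p A11 * Tt"
    unfolding Bs(1) Tt_eq by (rule hstack_mult_vstack[OF A11(1) S, symmetric])
  have B2: "B2 = hstack k q p C * Tt"
    unfolding Bs(2) Tt_eq by (rule hstack_mult_vstack[OF C(1) S, symmetric])

  \<comment> \<open>The off-diagonal blocks from the pseudoinverse\<close>
  define K where "K = B2 * pinv Tt"
  have pinv_c: "pinv Tt \<in> carrier_mat p (k * p)" by (rule pinv_carrier[OF Tt_c])
  have K: "K \<in> carrier_mat q (k * p)"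
    unfolding K_def using B(2) pinv_c by (simp add: q_def)
  define A21 where "A21 j = mat q p (\<lambda>(a, b). K $$ (a, j * p + b))" for j
  have A21: "A21 j \<in> carrier_mat q p" for j by (simp add: A21_def)
  have A21_hstack: "hstack k q p A21 = K"
    unfolding A21_def by (rule hstack_slices[OF K])
  \<comment> \<open>The factor \<open>Tt\<close> split off from \<open>B2\<close> meets
    \<open>pinv Tt * Tt\<close>, so the first Penrose condition applies and no rank assumption on
    \<open>Tt\<close> enters.\<close>
  have "K * Tt = hstack k q p C * (Tt * pinv Tt * Tt)"
    unfolding K_def B2
    using assoc_mult_mat[OF hstack_carrier[of k q p C] Tt_c pinv_c]
      assoc_mult_mat[OF hstack_carrier[of k q p C] mult_carrier_mat[OF Tt_c pinv_c] Tt_c] by simp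
  then have KT: "K * Tt = B2" by (simp only: pinv_generalized_inverse B2)
  have A21_sum: "msum q p k (\<lambda>j. A21 j * S j) = B2"
    using hstack_mult_vstack[of k A21 q p S p, OF A21 S] A21_hstack KT by (simp add: Tt_eq)

  \<comment> \<open>Reality of \<open>T\<close>, \<open>Tt\<close> and the blocks
    \<open>A21\<close>\<close>
  have T_real: "real_entries T"
  proof -
    \<comment> \<open>The columns of \<open>Q1\<close> are columns of the real matrix
      \<open>Q\<close>. Then \<open>T\<close> is real because orthonormality gives
      \<open>T = mat_adjoint Q1 * V\<close>.\<close>
    have "real_entries Q1"
      unfolding real_entries_index
    proof (intro allI impI)
      fix i j assume "i < dim_row Q1" "j < dim_col Q1"
      then have ij: "i < n" "j < p" using QR(1) by auto
      then have "Q1 $$ (i, j) = col Q j $ i" using Q(4)[of j] QR(1) by simp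
      also have "\<dots> = Q $$ (i, j)" using Q(1) ij pn by simp
      finally show "Q1 $$ (i, j) \<in> \<real>" using Q(1,2) ij pn by (simp add: real_entries_index)
    qed
    then have "real_entries (mat_adjoint Q1)" by (simp add: real_entries_index)
    then have "real_entries (mat_adjoint Q1 * V)"
      by (rule real_entries_mult[OF _ V(2) mat_adjoint_carrier[OF QR(1)] V(1)])
    moreover have "mat_adjoint Q1 * V = T"
      using assoc_mult_mat[OF mat_adjoint_carrier[OF QR(1)] QR(1,3)] QR(1-3)
      by (simp add: QR(5) orthonormal_cols_def)
    ultimately show ?thesis by simp
  qed
  have S_real: "real_entries (S j)" if "j < k" for j
    unfolding S_def by (rule real_entries_mult[OF T_real D_real[OF that] QR(3) D])
  have "real_entries Tt" unfolding Tt_eq by (rule real_entries_vstack[OF S S_real])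
  then have "real_entries (pinv Tt)" by (rule real_entries_pinv)
  moreover have "real_entries B2"
    unfolding Bs(2) by (rule real_entries_msum[OF mult_carrier_mat[OF C(1) S] real_entries_mult[OF C(2) S_real C(1) S]])
  ultimately have K_real: "real_entries K"
    unfolding K_def using real_entries_mult[OF _ _ B(2) pinv_c] by simp
  have A21_real: "real_entries (A21 j)" if "j < k" for j
    using K_real K block_index_less[OF that] by (simp add: A21_def real_entries_index)

  \<comment> \<open>The perturbations and their symmetry and reality\<close>
  define M where "M j = four_block_mat (A11 j) (transpose_mat (A21 j)) (A21 j) (0\<^sub>m q q)" for j
  have M: "M j \<in> carrier_mat n n" "symmetric_matrix (M j)" "real_entries (M j)" if "j < k" for j
  proof -
    have At: "transpose_mat (A21 j) \<in> carrier_mat p q" using A21 by simp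
    show "M j \<in> carrier_mat n n" using A11(1)[OF that] A21 n by (simp add: M_def)
    show "symmetric_matrix (M j)"
      using transpose_four_block_mat[OF A11(1)[OF that] At A21 zero_carrier_mat[of q q]] A11(2)[OF that]
      by (simp add: M_def symmetric_matrix_def)
    show "real_entries (M j)" unfolding M_def
      by (rule real_entries_four_block[OF A11(1)[OF that] At A21 zero_carrier_mat])
        (use A11(3) A21_real real_entries_transpose that in \<open>auto simp: real_entries_index\<close>)
  qed
  define dF where "dF j = Q * M j * ?Qt" for j
  have QM: "Q * M j \<in> carrier_mat n n" if "j < k" for j using Q(1) M(1)[OF that] by simp
  have dF: "dF j \<in> carrier_mat n n" "real_entries (dF j)" "symmetric_matrix (dF j)" if "j < k" for j
  proof -
    show "dF j \<in> carrier_mat n n" unfolding dF_def by (rule mult_carrier_mat[OF QM[OF that] Qt])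
    show "symmetric_matrix (dF j)" unfolding dF_def by (rule symmetric_congruence[OF Q(1) M(1,2)[OF that]])
    show "real_entries (dF j)" unfolding dF_def
      by (rule real_entries_mult[OF _ real_entries_transpose[OF Q(2)] QM[OF that] Qt])
        (rule real_entries_mult[OF Q(2) M(3)[OF that] Q(1) M(1)[OF that]])
  qed

  \<comment> \<open>Vanishing of the perturbed residual\<close>
  have dFVD: "dF j * V * D j = Q * (M j * X j)" if "j < k" for j
  proof -
    have "dF j * V * D j = dF j * (Q * X j)"
      by (simp only: assoc_mult_mat[OF dF(1)[OF that] V(1) D] VD)
    also have "\<dots> = Q * M j * (?Qt * (Q * X j))"
      unfolding dF_def by (rule assoc_mult_mat[OF QM[OF that] Qt mult_carrier_mat[OF Q(1) X]])
    also have "?Qt * (Q * X j) = X j"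
      by (simp only: assoc_mult_mat[OF Qt Q(1) X, symmetric] ortho(1) left_mult_one_mat[OF X])
    finally show ?thesis by (simp only: assoc_mult_mat[OF Q(1) M(1)[OF that] X])
  qed
  have MX: "M j * X j = (A11 j * S j) @\<^sub>r (A21 j * S j)" if "j < k" for j
    unfolding M_def X_def
    by (rule four_block_mult_append_rows_zero[OF A11(1)[OF that] _ A21 zero_carrier_mat S])
      (use A21 in simp)
  have MX_c: "M j * X j \<in> carrier_mat n p" if "j < k" for j
    by (rule mult_carrier_mat[OF M(1)[OF that] X])
  have "msum n p k (\<lambda>j. dF j * V * D j) = Q * msum n p k (\<lambda>j. M j * X j)"
    using mult_msum[of Q n n k "\<lambda>j. M j * X j" p, OF Q(1) MX_c] msum_cong[OF dFVD, of k] by simp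
  also have "msum n p k (\<lambda>j. M j * X j) = msum n p k (\<lambda>j. (A11 j * S j) @\<^sub>r (A21 j * S j))"
    by (rule msum_cong) (rule MX)
  also have "\<dots> = msum p p k (\<lambda>j. A11 j * S j) @\<^sub>r msum q p k (\<lambda>j. A21 j * S j)"
    unfolding n by (rule msum_append_rows[OF mult_carrier_mat[OF A11(1) S] mult_carrier_mat[OF A21 S]])
  \<comment> \<open>Both block equations enter here: the upper sum is \<open>B1\<close>, and the
    lower sum is \<open>B2\<close> by the choice of \<open>A21\<close>. Multiplying by
    \<open>Q\<close> then gives \<open>- R\<close>, since \<open>Q\<close> times its transpose is
    the identity.\<close>
  also have "\<dots> = - (?Qt * R)" using Bs(1) A21_sum B(3) by simp
  also have "Q * (- (?Qt * R)) = - (Q * (?Qt * R))"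
    using Q(1) R_c by simp
  also have "Q * (?Qt * R) = R"
    by (simp only: assoc_mult_mat[OF Q(1) Qt R_c, symmetric] ortho(2) left_mult_one_mat[OF R_c])
  finally have dF_sum: "msum n p k (\<lambda>j. dF j * V * D j) = - R" .
  have dFVD_c: "dF j * V * D j \<in> carrier_mat n p" if "j < k" for j
    using dF(1)[OF that] V(1) D[of j] by (blast intro: mult_carrier_mat)
  have "residual n p k (\<lambda>j. F j + dF j) f V Lam = msum n p k (\<lambda>j. F j * V * D j + dF j * V * D j)"
    unfolding residual_def D_def[symmetric]
  proof (rule msum_cong)
    fix j assume j: "j < k"
    have "F j * V \<in> carrier_mat n p" "dF j * V \<in> carrier_mat n p"
      using F(1)[OF j] dF(1)[OF j] V(1) by auto
    then show "(F j + dF j) * V * D j = F j * V * D j + dF j * V * D j"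
      by (simp only: add_mult_distrib_mat[OF F(1)[OF j] dF(1)[OF j] V(1)] add_mult_distrib_mat[OF _ _ D])
  qed
  also have "\<dots> = R + - R"
    using msum_add[of k "\<lambda>j. F j * V * D j" n p "\<lambda>j. dF j * V * D j", OF FVD_c dFVD_c] dF_sum
    by (simp add: R residual_def D_def)
  also have "\<dots> = 0\<^sub>m n p" using R_c by (intro eq_matI) auto
  finally have res: "residual n p k (\<lambda>j. F j + dF j) f V Lam = 0\<^sub>m n p" .
  have "M_S p k Tt *\<^sub>v vstack_vec k (p * p) (\<lambda>j. vec_of_cols (A11 j))
      = vec_of_cols B1 @\<^sub>v 0\<^sub>v (k * (p * p))"
    unfolding B1 by (rule M_S_mult_vec[OF Tt_c A11(1,2)])
  moreover have "hstack k q p A21 = B2 * pinv Tt" using A21_hstack by (simp add: K_def)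
  ultimately show ?thesis
    unfolding q_def[symmetric] using dF res A11(1) A21
    by (intro exI[of _ dF] exI[of _ A11] exI[of _ A21]) (simp add: dF_def M_def)
qed

end
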